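(* Let $n \ge 4$ and $t$ be integers. Let $k \ge 1$, let $a_1,\dots,a_k>0$ be real numbers, let $s_1,\dots,s_k \in \{0,1,\dots,n-1\}$ be integers, and let $W_1,\dots,W_k>0$ be real numbers such that \[ \frac{1}{|\mathbb{S}^{n-1}|}\int_{\mathbb{S}^{n-1}} f(y)\,d\rho(y) = \sum_{i=1}^k W_i \sum_{x \in v_{a_i,s_i}^{B_n}} f(x) \] for every real polynomial $f$ in $n$ variables of degree at most $t$. Then $t \le 15$.
   Context: $\mathbb{S}^{n-1}\subset\mathbb{R}^n$ is the unit sphere, $\rho$ its surface measure and $|\mathbb{S}^{n-1}|$ its surface area. For $a>0$ and an integer $0\le s\le n-1$, the generalized corner vector is $v_{a,s} = (a^2+s)^{-1/2}(a,\underbrace{1,\dots,1}_{s},0,\dots,0)\in\mathbb{S}^{n-1}$. $B_n$ is the hyperoctahedral group acting on $\mathbb{R}^n$ by permutations of coordinates and sign changes of coordinates, and $x^{B_n}$ denotes the $B_n$-orbit of $x$. *)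

theory Defs
  imports "HOL-Analysis.Analysis"
begin

(* Surface measure on the unit sphere: the cone over A has Lebesgue measure rho(A) / n,
   where n = DIM('a); see emeasure_sphere_measure. *)
definition sphere_measure :: "'a::euclidean_space measure" where
  "sphere_measure =
     scale_measure (of_nat DIM('a))
       (distr (restrict_space lborel (cball 0 1 - {0})) (restrict_space borel (sphere 0 1))
         (\<lambda>x. x /\<^sub>R norm x))"

lemma space_sphere_measure: "space (sphere_measure :: 'a::euclidean_space measure) = sphere 0 1"
  by (simp add: sphere_measure_def space_scale_measure)

lemma sets_sphere_measure:
  "sets (sphere_measure :: 'a::euclidean_space measure) = sets (restrict_space borel (sphere 0 1))"
  by (simp add: sphere_measure_def)

lemma emeasure_sphere_measure:
  fixes A :: "'a::euclidean_space set"
  assumes "A \<in> sets sphere_measure"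
  shows "emeasure sphere_measure A =
           of_nat DIM('a) * emeasure lborel {r *\<^sub>R x |r x. 0 < r \<and> r \<le> 1 \<and> x \<in> A}"
proof -
  let ?N = "restrict_space borel (sphere 0 1) :: 'a measure"
  let ?D = "restrict_space lborel (cball 0 1 - {0}) :: 'a measure"
  have A: "A \<in> sets ?N" using assms by (simp add: sets_sphere_measure)
  then have sub: "A \<subseteq> sphere 0 1"
    using sets.sets_into_space by fastforce
  have meas: "(\<lambda>x. x /\<^sub>R norm x) \<in> measurable ?D ?N"
  proof (rule measurable_restrict_space2)
    show "(\<lambda>x. x /\<^sub>R norm x) \<in> space ?D \<rightarrow> sphere 0 1"
      by (auto simp: space_restrict_space)
    show "(\<lambda>x. x /\<^sub>R norm x) \<in> measurable ?D borel"
      by (rule measurable_restrict_space1) simp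
  qed
  have eq: "(\<lambda>x. x /\<^sub>R norm x) -` A \<inter> space ?D = {r *\<^sub>R x |r x. 0 < r \<and> r \<le> 1 \<and> x \<in> A}"
    (is "?L = ?R")
  proof (intro set_eqI iffI)
    fix y assume y: "y \<in> ?L"
    then have "y = norm y *\<^sub>R (y /\<^sub>R norm y) \<and> 0 < norm y \<and> norm y \<le> 1 \<and> y /\<^sub>R norm y \<in> A"
      by (auto simp: space_restrict_space)
    then show "y \<in> ?R" by blast
  next
    fix y assume "y \<in> ?R"
    then obtain r x where y: "y = r *\<^sub>R x" and r: "0 < r" "r \<le> 1" and x: "x \<in> A" by blast
    from x sub have "norm x = 1" by auto
    with y r x show "y \<in> ?L"
      by (auto simp: space_restrict_space)
  qed
  have "emeasure (distr ?D ?N (\<lambda>x. x /\<^sub>R norm x)) A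
          = emeasure ?D ((\<lambda>x. x /\<^sub>R norm x) -` A \<inter> space ?D)"
    by (rule emeasure_distr[OF meas A])
  also have "\<dots> = emeasure lborel ((\<lambda>x. x /\<^sub>R norm x) -` A \<inter> space ?D)"
    by (rule emeasure_restrict_space) (auto simp: space_restrict_space)
  finally show ?thesis
    unfolding eq by (simp add: sphere_measure_def)
qed

(* The coefficient function c is indexed by the exponents alpha of the monomials; t is an
   integer, and for t < 0 only the zero polynomial remains. *)
definition is_polynomial_deg_le :: "int \<Rightarrow> (real ^ 'n::finite \<Rightarrow> real) \<Rightarrow> bool" where
  "is_polynomial_deg_le t f \<longleftrightarrow>
     (\<exists>c :: ('n \<Rightarrow> nat) \<Rightarrow> real.
        f = (\<lambda>x. \<Sum>\<alpha> | int (\<Sum>i\<in>UNIV. \<alpha> i) \<le> t. c \<alpha> * (\<Prod>i\<in>UNIV. (x $ i) ^ \<alpha> i)))"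

lemma finite_exponents_deg_le: "finite {\<alpha> :: 'n::finite \<Rightarrow> nat. int (\<Sum>i\<in>UNIV. \<alpha> i) \<le> t}"
proof (rule finite_subset)
  show "{\<alpha> :: 'n \<Rightarrow> nat. int (\<Sum>i\<in>UNIV. \<alpha> i) \<le> t} \<subseteq> PiE UNIV (\<lambda>_. {..nat t})"
  proof (intro subsetI PiE_I)
    fix \<alpha> :: "'n \<Rightarrow> nat" and i
    assume "\<alpha> \<in> {\<alpha>. int (\<Sum>i\<in>UNIV. \<alpha> i) \<le> t}"
    moreover have "\<alpha> i \<le> (\<Sum>i\<in>UNIV. \<alpha> i)" by (rule member_le_sum) auto
    ultimately show "\<alpha> i \<in> {..nat t}" by (simp only: mem_Collect_eq atMost_iff)
  qed simp
next
  show "finite (PiE (UNIV :: 'n set) (\<lambda>_. {..nat t}))" by (intro finite_PiE) auto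
qed

(* The coordinates are numbered from 0 along the linear order of the index type. *)
definition coord_pos :: "'n::{finite,linorder} \<Rightarrow> nat" where
  "coord_pos i = card {j. j < i}"

definition corner_vector :: "real \<Rightarrow> nat \<Rightarrow> real ^ 'n::{finite,linorder}" where
  "corner_vector a s =
     (1 / sqrt (a\<^sup>2 + real s)) *\<^sub>R
       (\<chi> i. if coord_pos i = 0 then a else if coord_pos i \<le> s then 1 else 0)"

definition hyperoctahedral_group :: "(real ^ 'n::finite \<Rightarrow> real ^ 'n) set" where
  "hyperoctahedral_group =
     {\<lambda>x. \<chi> i. \<epsilon> i * x $ \<pi> i |\<epsilon> \<pi>. (\<forall>i. \<epsilon> i \<in> {1, -1}) \<and> \<pi> permutes UNIV}"

definition hyperoctahedral_orbit :: "real ^ 'n::finite \<Rightarrow> (real ^ 'n) set" where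
  "hyperoctahedral_orbit x = (\<lambda>g. g x) ` hyperoctahedral_group"

end

theory Submission
  imports Defs
begin

text \<open>
  At an orbit point at most one coordinate comes from the entry \<open>a\<close>; the squares of all the
  others are \<open>0\<close> or a common value. Hence of the pairs \<open>(x\<^sub>p, x\<^sub>q)\<close> and \<open>(x\<^sub>r, x\<^sub>u)\<close> one avoids
  \<open>a\<close>: its two squares are equal or one of them is \<open>0\<close>. So
  \<open>x\<^sub>p x\<^sub>q x\<^sub>r x\<^sub>u (x\<^sub>p\<^sup>2 - x\<^sub>q\<^sup>2) (x\<^sub>r\<^sup>2 - x\<^sub>u\<^sup>2)\<close>, which has degree \<open>8\<close>, vanishes at every node. Its
  square has degree \<open>16\<close> and a positive mean over the sphere.
\<close>

section \<open>Closure properties of polynomials of bounded degree\<close>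

lemma is_polynomial_deg_le_zero: "is_polynomial_deg_le t (\<lambda>x. 0)"
  unfolding is_polynomial_deg_le_def by (rule exI[of _ "\<lambda>_. 0"]) simp

lemma is_polynomial_deg_le_add:
  assumes "is_polynomial_deg_le t f" and "is_polynomial_deg_le t g"
  shows "is_polynomial_deg_le t (\<lambda>x. f x + g x)"
proof -
  obtain c d where
    "f = (\<lambda>x. \<Sum>\<alpha> | int (\<Sum>i\<in>UNIV. \<alpha> i) \<le> t. c \<alpha> * (\<Prod>i\<in>UNIV. (x $ i) ^ \<alpha> i))"
    "g = (\<lambda>x. \<Sum>\<alpha> | int (\<Sum>i\<in>UNIV. \<alpha> i) \<le> t. d \<alpha> * (\<Prod>i\<in>UNIV. (x $ i) ^ \<alpha> i))"
    using assms unfolding is_polynomial_deg_le_def by blast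
  then show ?thesis
    unfolding is_polynomial_deg_le_def
    by (intro exI[of _ "\<lambda>\<alpha>. c \<alpha> + d \<alpha>"]) (simp only: distrib_right sum.distrib)
qed

lemma is_polynomial_deg_le_sum:
  assumes "\<And>j. j \<in> J \<Longrightarrow> is_polynomial_deg_le t (f j)"
  shows "is_polynomial_deg_le t (\<lambda>x. \<Sum>j\<in>J. f j x)"
  using assms
  by (induction J rule: infinite_finite_induct)
    (auto intro: is_polynomial_deg_le_zero is_polynomial_deg_le_add)

lemma is_polynomial_deg_le_monomial:
  fixes \<beta> :: "'n::finite \<Rightarrow> nat"
  assumes "int (\<Sum>i\<in>UNIV. \<beta> i) \<le> t"
  shows "is_polynomial_deg_le t (\<lambda>x. b * (\<Prod>i\<in>UNIV. (x $ i) ^ \<beta> i))"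
  unfolding is_polynomial_deg_le_def
proof (intro exI ext)
  fix x :: "real ^ 'n"
  show "b * (\<Prod>i\<in>UNIV. (x $ i) ^ \<beta> i) =
    (\<Sum>\<alpha> | int (\<Sum>i\<in>UNIV. \<alpha> i) \<le> t.
      (if \<alpha> = \<beta> then b else 0) * (\<Prod>i\<in>UNIV. (x $ i) ^ \<alpha> i))"
    \<comment> \<open>Finiteness of the set of exponents lets the sum collapse to its term at
      \<beta>; over an infinite set it would be 0 by convention.\<close>
    using assms finite_exponents_deg_le[where 'n='n, of t]
    by (simp add: if_distrib[where f = "\<lambda>c. c * _"] sum.delta' flip: of_nat_sum cong: if_cong)
qed

lemma is_polynomial_deg_le_monomial_four:
  fixes p q r u :: "'n::finite"
  assumes "distinct [p, q, r, u]" and "int (k + l + m + h) \<le> t"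
  shows "is_polynomial_deg_le t (\<lambda>x. b * (x $ p ^ k * x $ q ^ l * x $ r ^ m * x $ u ^ h))"
proof -
  define \<beta> where "\<beta> = (\<lambda>i. if i = p then k else if i = q then l else if i = r then m
    else if i = u then h else 0)"
  have "(\<Sum>i\<in>UNIV. \<beta> i) = (\<Sum>i\<in>{p, q, r, u}. \<beta> i)"
    by (rule sum.mono_neutral_right) (auto simp: \<beta>_def)
  then have deg: "(\<Sum>i\<in>UNIV. \<beta> i) = k + l + m + h"
    using assms(1) by (auto simp: \<beta>_def)
  have "(\<Prod>i\<in>UNIV. (x $ i) ^ \<beta> i) = x $ p ^ k * x $ q ^ l * x $ r ^ m * x $ u ^ h"
    for x :: "real ^ 'n"
  proof -
    have "(\<Prod>i\<in>UNIV. (x $ i) ^ \<beta> i) = (\<Prod>i\<in>{p, q, r, u}. (x $ i) ^ \<beta> i)"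
      by (rule prod.mono_neutral_right) (auto simp: \<beta>_def)
    then show ?thesis
      using assms(1) by (auto simp: \<beta>_def)
  qed
  then show ?thesis
    using is_polynomial_deg_le_monomial[of \<beta> t b] deg assms(2) by simp
qed

section \<open>The test polynomial: its degree and its zeros at the nodes\<close>

definition witness :: "'n \<Rightarrow> 'n \<Rightarrow> 'n \<Rightarrow> 'n \<Rightarrow> real ^ 'n::finite \<Rightarrow> real" where
  "witness p q r u x =
     (x $ p * x $ q * x $ r * x $ u * ((x $ p)\<^sup>2 - (x $ q)\<^sup>2) * ((x $ r)\<^sup>2 - (x $ u)\<^sup>2))\<^sup>2"

lemma is_polynomial_witness:
  fixes p q r u :: "'n::finite"
  assumes "distinct [p, q, r, u]" and "16 \<le> t"
  shows "is_polynomial_deg_le t (witness p q r u)"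
proof -
  \<comment> \<open>The values 1, -2, 1 are the coefficients of \<open>(y^2 - z^2)^2\<close>. The
    factor \<open>(y * z)^2\<close> shifts the exponents, so each monomial in y and z has degree
    8.\<close>
  define c :: "nat \<Rightarrow> real" where "c i = (if i = 1 then -2 else 1)" for i
  have square: "(y * z * (y\<^sup>2 - z\<^sup>2))\<^sup>2 = (\<Sum>i\<le>2. c i * (y ^ (2 + 2 * i) * z ^ (6 - 2 * i)))"
    for y z :: real
    by (simp add: c_def atMost_nat_numeral eval_nat_numeral) (simp add: algebra_simps)
  \<comment> \<open>The square splits into one factor for \<open>p, q\<close> and one for
    \<open>r, u\<close>. Their product has nine monomials, each of degree 8 + 8 = 16.\<close>
  have "witness p q r u = (\<lambda>x. \<Sum>i\<le>2. \<Sum>j\<le>2. c i * c j *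
    (x $ p ^ (2 + 2 * i) * x $ q ^ (6 - 2 * i) * x $ r ^ (2 + 2 * j) * x $ u ^ (6 - 2 * j)))"
  proof
    fix x
    have "witness p q r u x = (x $ p * x $ q * ((x $ p)\<^sup>2 - (x $ q)\<^sup>2))\<^sup>2 *
      (x $ r * x $ u * ((x $ r)\<^sup>2 - (x $ u)\<^sup>2))\<^sup>2"
      unfolding witness_def power_mult_distrib by (simp only: mult_ac)
    then show "witness p q r u x = (\<Sum>i\<le>2. \<Sum>j\<le>2. c i * c j *
      (x $ p ^ (2 + 2 * i) * x $ q ^ (6 - 2 * i) * x $ r ^ (2 + 2 * j) * x $ u ^ (6 - 2 * j)))"
      unfolding square sum_product by (simp only: mult_ac)
  qed
  moreover have "is_polynomial_deg_le t (\<lambda>x. \<Sum>i\<le>2. \<Sum>j\<le>2. c i * c j *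
    (x $ p ^ (2 + 2 * i) * x $ q ^ (6 - 2 * i) * x $ r ^ (2 + 2 * j) * x $ u ^ (6 - 2 * j)))"
    using assms
    by (intro is_polynomial_deg_le_sum is_polynomial_deg_le_monomial_four) auto
  ultimately show ?thesis by simp
qed

lemma coord_pos_eq_0_iff: "coord_pos i = 0 \<longleftrightarrow> (\<forall>j. i \<le> j)"
  by (auto simp: coord_pos_def not_less)

lemma witness_orbit_corner_vector:
  fixes p q r u :: "'n::{finite,linorder}"
  assumes "distinct [p, q, r, u]"
    and "x \<in> hyperoctahedral_orbit (corner_vector a s)"
  shows "witness p q r u x = 0"
proof -
  obtain \<epsilon> \<pi> where \<epsilon>: "\<And>i. \<epsilon> i \<in> {1, -1::real}" and \<pi>: "\<pi> permutes UNIV"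
    and x: "x = (\<chi> i. \<epsilon> i * corner_vector a s $ \<pi> i)"
    using assms(2) unfolding hyperoctahedral_orbit_def hyperoctahedral_group_def by blast
  \<comment> \<open>Position 0 belongs to the least index alone, and \<open>\<pi>\<close> is
    injective.\<close>
  have unique: "i = j" if "coord_pos (\<pi> i) = 0" "coord_pos (\<pi> j) = 0" for i j
    using that permutes_inj[OF \<pi>] by (metis coord_pos_eq_0_iff inj_eq order.antisym)
  \<comment> \<open>Away from the entry \<open>a\<close>, signs disappear on squaring: each square
    is 0 or \<open>(1 / sqrt (a^2 + s))^2\<close>.\<close>
  have pair: "x $ i * x $ j * ((x $ i)\<^sup>2 - (x $ j)\<^sup>2) = 0"
    if "coord_pos (\<pi> i) \<noteq> 0" "coord_pos (\<pi> j) \<noteq> 0" for i j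
    using that \<epsilon>[of i] \<epsilon>[of j] by (auto simp: x corner_vector_def)
  \<comment> \<open>If both pairs met the entry \<open>a\<close>, an index of one pair would equal
    an index of the other.\<close>
  have "x $ p * x $ q * ((x $ p)\<^sup>2 - (x $ q)\<^sup>2) = 0 \<or> x $ r * x $ u * ((x $ r)\<^sup>2 - (x $ u)\<^sup>2) = 0"
    using pair unique assms(1) by (metis distinct_length_2_or_more)
  then show ?thesis
    by (auto simp: witness_def)
qed

section \<open>Positivity of integrals over the sphere\<close>

lemma emeasure_sphere_measure_nonzero_pos:
  fixes f :: "'a::euclidean_space \<Rightarrow> real"
  assumes "continuous_on UNIV f"
    and hom: "\<And>c x. f (c *\<^sub>R x) = c ^ d * f x"
    and z: "z \<noteq> 0" "f z \<noteq> 0"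
  shows "emeasure sphere_measure {x \<in> sphere 0 1. f x \<noteq> 0} > 0"
proof -
  let ?A = "{x \<in> sphere 0 1. f x \<noteq> 0}"
  let ?U = "{x. f x \<noteq> 0} \<inter> (ball 0 1 - {0})"
  let ?V = "{x. f x \<noteq> 0} \<inter> (cball 0 1 - {0})"
  have open_f: "open {x. f x \<noteq> 0}"
    using assms(1) by (intro open_Collect_neq continuous_on_const)
  have "?A = sphere 0 1 \<inter> {x. f x \<noteq> 0}" by auto
  then have A: "?A \<in> sets sphere_measure"
    unfolding sets_sphere_measure sets_restrict_space using open_f by auto
  \<comment> \<open>By homogeneity, vanishing of \<open>f\<close> is constant along open rays from
    0, so the cone over \<open>?A\<close> is the whole nonvanishing part of the punctured
    ball.\<close>
  have cone: "{r *\<^sub>R x |r x. 0 < r \<and> r \<le> 1 \<and> x \<in> ?A} = ?V"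
  proof (intro set_eqI iffI)
    fix y assume y: "y \<in> ?V"
    then have "y = norm y *\<^sub>R (y /\<^sub>R norm y)" "f (y /\<^sub>R norm y) \<noteq> 0"
      by (auto simp: hom)
    with y show "y \<in> {r *\<^sub>R x |r x. 0 < r \<and> r \<le> 1 \<and> x \<in> ?A}"
      by (intro CollectI exI[of _ "norm y"] exI[of _ "y /\<^sub>R norm y"]) auto
  qed (auto simp: hom)
  \<comment> \<open>Rescaling \<open>z\<close> to norm 1/2 puts it inside the open ball, so the open
    set \<open>?U\<close> is nonempty and cannot be negligible.\<close>
  have "(1 / (2 * norm z)) *\<^sub>R z \<in> ?U"
    using z by (auto simp: hom)
  moreover have "open ?U" using open_f by auto
  ultimately have "\<not> negligible ?U" using open_not_negligible by blast
  moreover have "?U \<in> null_sets lborel" if "emeasure lborel ?V = 0"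
  proof (rule null_sets_subset)
    show "?V \<in> null_sets lborel" using that open_f by auto
    show "?U \<in> sets lborel" using \<open>open ?U\<close> by simp
    show "?U \<subseteq> ?V" by auto
  qed
  \<comment> \<open>Negligibility refers to the completed measure, where null sets of
    \<open>lborel\<close> stay null.\<close>
  ultimately have "emeasure lborel ?V \<noteq> 0"
    using null_sets_completionI negligible_iff_null_sets by blast
  then show ?thesis
    unfolding emeasure_sphere_measure[OF A] cone
    by (simp add: zero_less_iff_neq_zero)
qed

text \<open>The cone over the sphere lies in the unit ball, which has finite volume. This makes
  bounded measurable functions integrable.\<close>

lemma finite_measure_sphere_measure:
  "finite_measure (sphere_measure :: 'a::euclidean_space measure)"
proof
  let ?S = "sphere_measure :: 'a measure"
  have "sphere 0 1 \<in> sets ?S"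
    using sets.top[of ?S] by (simp add: space_sphere_measure)
  then have "emeasure ?S (sphere 0 1) =
      of_nat DIM('a) * emeasure lborel {r *\<^sub>R x |r x. 0 < r \<and> r \<le> 1 \<and> x \<in> sphere (0::'a) 1}"
    by (rule emeasure_sphere_measure)
  also have "\<dots> \<le> of_nat DIM('a) * emeasure lborel (cball (0::'a) 1)"
    by (intro mult_left_mono emeasure_mono) auto
  also have "\<dots> < \<infinity>"
    using emeasure_lborel_cball_finite[of "0::'a" 1]
    by (simp add: ennreal_mult_less_top of_nat_less_top)
  finally show "emeasure ?S (space ?S) \<noteq> \<infinity>"
    by (simp add: space_sphere_measure)
qed

text \<open>A nonnegative integrable function with integral 0 vanishes almost everywhere, but here
  the nonvanishing set has positive measure. Integrability comes from boundedness on the compact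
  sphere.\<close>

lemma integral_sphere_measure_pos:
  fixes f :: "'a::euclidean_space \<Rightarrow> real"
  assumes cont: "continuous_on UNIV f"
    and "\<And>x. f x \<ge> 0"
    and "\<And>c x. f (c *\<^sub>R x) = c ^ d * f x"
    and "z \<noteq> 0" "f z \<noteq> 0"
  shows "(\<integral>y. f y \<partial>sphere_measure) > 0"
proof -
  let ?S = "sphere_measure :: 'a measure"
  interpret finite_measure ?S by (rule finite_measure_sphere_measure)
  have meas: "f \<in> borel_measurable ?S"
    using measurable_restrict_space1[OF borel_measurable_continuous_onI[OF cont]]
    by (simp add: measurable_cong_sets[OF sets_sphere_measure refl])
  have "compact (f ` sphere 0 1)"
    using cont by (intro compact_continuous_image compact_sphere) (rule continuous_on_subset, auto)
  then obtain B where "\<And>x. x \<in> sphere 0 1 \<Longrightarrow> norm (f x) \<le> B"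
    using compact_imp_bounded bounded_iff by (metis imageI)
  then have int: "integrable ?S f"
    using meas by (intro integrable_const_bound[of _ B] AE_I2) (auto simp: space_sphere_measure)
  have "emeasure ?S {x \<in> sphere 0 1. f x \<noteq> 0} > 0"
    using assms by (intro emeasure_sphere_measure_nonzero_pos) auto
  moreover have nonzero_meas: "{x \<in> sphere 0 1. f x \<noteq> 0} \<in> sets ?S"
    using meas unfolding space_sphere_measure[symmetric] by measurable
  ultimately have "\<not> (AE x in ?S. f x = 0)"
    using AE_iff_measurable[OF nonzero_meas, of "\<lambda>x. f x = 0"]
    by (simp add: space_sphere_measure)
  then have "(\<integral>y. f y \<partial>?S) \<noteq> 0"
    using integral_nonneg_eq_0_iff_AE[OF int] assms(2) by auto
  moreover have "(\<integral>y. f y \<partial>?S) \<ge> 0"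
    using assms(2) by (rule Bochner_Integration.integral_nonneg)
  ultimately show ?thesis by simp
qed

lemma measure_sphere_measure_pos:
  "measure sphere_measure (sphere (0 :: 'a::euclidean_space) 1) > 0"
proof -
  obtain b :: 'a where "b \<in> Basis"
    using nonempty_Basis by blast
  then have "0 < (\<integral>y. (1::real) \<partial>(sphere_measure :: 'a measure))"
    \<comment> \<open>The constant 1 is homogeneous of degree 0, and its integral is the total
      mass.\<close>
    by (intro integral_sphere_measure_pos[where d = 0 and z = b]) (auto simp: nonzero_Basis)
  then show ?thesis by (simp add: space_sphere_measure)
qed

lemma integral_witness_pos:
  fixes p q r u :: "'n::finite"
  assumes "distinct [p, q, r, u]"
  shows "(\<integral>y. witness p q r u y \<partial>sphere_measure) > 0"
proof (rule integral_sphere_measure_pos)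
  let ?w = "witness p q r u"
  \<comment> \<open>No coordinate of \<open>?z\<close> is 0, and each pair has the squares 1 and 4,
    so no factor of \<open>witness\<close> vanishes. By homogeneity \<open>?z\<close> may lie off
    the sphere.\<close>
  let ?z = "\<chi> i. if i = q \<or> i = u then 2 else (1 :: real)"
  show "continuous_on UNIV ?w"
    unfolding witness_def by (intro continuous_intros)
  show "?w x \<ge> 0" for x by (simp add: witness_def)
  show "?w (c *\<^sub>R x) = c ^ 16 * ?w x" for c x
    by (simp add: witness_def power2_eq_square eval_nat_numeral algebra_simps)
  show "?w ?z \<noteq> 0" using assms by (auto simp: witness_def)
  show "?z \<noteq> 0" by (auto simp: vec_eq_iff)
qed

lemma obtain_four_distinct:
  assumes "4 \<le> CARD('a::finite)"
  obtains p q r u :: "'a::finite" where "distinct [p, q, r, u]"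
proof -
  obtain P :: "'a set" where "card P = 4"
    using obtain_subset_with_card_n[OF assms] by blast
  then obtain ps :: "'a list" where "distinct ps" "length ps = 4"
    using finite_distinct_list[of P] distinct_card card.infinite by fastforce
  then show ?thesis
    using that by (auto simp: length_Suc_conv eval_nat_numeral)
qed

theorem theorem3p1:
  fixes t :: int and k :: nat
    and a W :: "nat \<Rightarrow> real" and s :: "nat \<Rightarrow> nat"
  assumes "CARD('n::{finite,linorder}) \<ge> 4"
    and "k \<ge> 1"
    and "\<And>i. i \<in> {1..k} \<Longrightarrow> a i > 0"
    and "\<And>i. i \<in> {1..k} \<Longrightarrow> s i \<in> {0..CARD('n::{finite,linorder}) - 1}"
    and "\<And>i. i \<in> {1..k} \<Longrightarrow> W i > 0"
    and "\<And>f :: real ^ 'n::{finite,linorder} \<Rightarrow> real. is_polynomial_deg_le t f \<Longrightarrow>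
           1 / measure sphere_measure (sphere (0 :: real ^ 'n::{finite,linorder}) 1) * (\<integral>y. f y \<partial>sphere_measure)
             = (\<Sum>i = 1..k. W i * (\<Sum>x\<in>hyperoctahedral_orbit (corner_vector (a i) (s i)). f x))"
  shows "t \<le> 15"
proof (rule ccontr)
  assume "\<not> t \<le> 15"
  then have t: "16 \<le> t" by simp
  obtain p q r u :: 'n where dist: "distinct [p, q, r, u]"
    using obtain_four_distinct[OF assms(1)] by blast
  \<comment> \<open>The surface area is positive, so normalising the integral keeps it
    positive.\<close>
  have "0 < 1 / measure sphere_measure (sphere (0 :: real ^ 'n::{finite,linorder}) 1) *
      (\<integral>y. witness p q r u y \<partial>sphere_measure)"
    by (intro mult_pos_pos divide_pos_pos integral_witness_pos[OF dist]
      measure_sphere_measure_pos) simp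
  also have "\<dots> = (\<Sum>i = 1..k. W i *
      (\<Sum>x\<in>hyperoctahedral_orbit (corner_vector (a i) (s i)). witness p q r u x))"
    using is_polynomial_witness[OF dist t] by (rule assms(6))
  also have "\<dots> = 0"
    using witness_orbit_corner_vector[OF dist] by simp
  finally show False by simp
qed

end
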